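(* Let $\mathbb{D}$ be the open unit disk in $\mathbb{C}$ and let $\varphi:\mathbb{D}\to\mathbb{D}$ be an analytic map such that $C_\varphi:f\mapsto f\circ\varphi$ is an isometry on the Bloch space of $\mathbb{D}$. (a) If $\varphi$ is not a rotation, then $\sigma(C_\varphi)=\overline{\mathbb{D}}$. (b) If $\varphi(z)=\lambda z$ with $|\lambda|=1$, then $$\sigma(C_\varphi)=\begin{cases}\partial\mathbb{D},&\text{if }\mathrm{ord}(\lambda)=\infty,\\ G,&\text{if }\mathrm{ord}(\lambda)<\infty,\end{cases}$$ where $G$ is the cyclic group generated by $\lambda$.
   Context: The Bloch space of $\mathbb{D}$ is the complex Banach space $\mathcal{B}$ of analytic $f:\mathbb{D}\to\mathbb{C}$ with $\beta_f=\sup_{z\in\mathbb{D}}(1-|z|^2)|f'(z)|<\infty$, with norm $\|f\|_{\mathcal{B}}=|f(0)|+\beta_f$. "Isometry" means $\|f\circ\varphi\|_{\mathcal{B}}=\|f\|_{\mathcal{B}}$ for all $f\in\mathcal{B}$. $\sigma(C_\varphi)$ is the spectrum of $C_\varphi$ as a bounded operator on $\mathcal{B}$. A rotation is a map $z\mapsto\lambda z$ with $|\lambda|=1$. $\mathrm{ord}(\lambda)$ is the smallest positive integer $k$ with $\lambda^k=1$, and $\infty$ if there is none. *)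

theory Defs
  imports "HOL-Complex_Analysis.Complex_Analysis" "HOL-Library.Extended_Nat"
begin

text \<open>
  Functions on the open unit disk are represented by total functions that vanish outside the
  disk, so that equality in HOL is equality on the disk.
\<close>

definition bloch_seminorm :: "(complex \<Rightarrow> complex) \<Rightarrow> real" where
  "bloch_seminorm f = (SUP z\<in>ball 0 1. (1 - (cmod z)\<^sup>2) * cmod (deriv f z))"

definition bloch_norm :: "(complex \<Rightarrow> complex) \<Rightarrow> real" where
  "bloch_norm f = cmod (f 0) + bloch_seminorm f"

definition bloch_space :: "(complex \<Rightarrow> complex) set" where
  "bloch_space = {f. f holomorphic_on ball 0 1 \<and> (\<forall>z. z \<notin> ball 0 1 \<longrightarrow> f z = 0) \<and>
     bdd_above ((\<lambda>z. (1 - (cmod z)\<^sup>2) * cmod (deriv f z)) ` ball 0 1)}"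

definition bloch_bounded_operator :: "((complex \<Rightarrow> complex) \<Rightarrow> (complex \<Rightarrow> complex)) \<Rightarrow> bool" where
  "bloch_bounded_operator T \<longleftrightarrow>
     (\<forall>f\<in>bloch_space. T f \<in> bloch_space) \<and>
     (\<forall>f\<in>bloch_space. \<forall>g\<in>bloch_space. T (\<lambda>z. f z + g z) = (\<lambda>z. T f z + T g z)) \<and>
     (\<forall>c. \<forall>f\<in>bloch_space. T (\<lambda>z. c * f z) = (\<lambda>z. c * T f z)) \<and>
     (\<exists>K. \<forall>f\<in>bloch_space. bloch_norm (T f) \<le> K * bloch_norm f)"

text \<open>
  The complement of the resolvent set: \<open>\<mu>\<close> is in the spectrum iff \<open>T - \<mu> I\<close> has no two-sided
  inverse among the bounded operators on the Bloch space.
\<close>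

definition bloch_spectrum :: "((complex \<Rightarrow> complex) \<Rightarrow> (complex \<Rightarrow> complex)) \<Rightarrow> complex set" where
  "bloch_spectrum T = {\<mu>. \<not> (\<exists>S. bloch_bounded_operator S \<and>
     (\<forall>f\<in>bloch_space. S (\<lambda>z. T f z - \<mu> * f z) = f \<and> (\<lambda>z. T (S f) z - \<mu> * S f z) = f))}"

definition composition_operator ::
    "(complex \<Rightarrow> complex) \<Rightarrow> (complex \<Rightarrow> complex) \<Rightarrow> (complex \<Rightarrow> complex)" where
  "composition_operator \<phi> f = (\<lambda>z. if z \<in> ball 0 1 then f (\<phi> z) else 0)"

definition bloch_isometry :: "((complex \<Rightarrow> complex) \<Rightarrow> (complex \<Rightarrow> complex)) \<Rightarrow> bool" where
  "bloch_isometry T \<longleftrightarrow> (\<forall>f\<in>bloch_space. bloch_norm (T f) = bloch_norm f)"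

definition disk_rotation :: "(complex \<Rightarrow> complex) \<Rightarrow> bool" where
  "disk_rotation \<phi> \<longleftrightarrow> (\<exists>l. cmod l = 1 \<and> (\<forall>z\<in>ball 0 1. \<phi> z = l * z))"

definition mult_order :: "complex \<Rightarrow> enat" where
  "mult_order l = (if \<exists>k::nat. k > 0 \<and> l ^ k = 1 then enat (LEAST k. k > 0 \<and> l ^ k = 1) else \<infinity>)"

definition cyclic_group_of :: "complex \<Rightarrow> complex set" where
  "cyclic_group_of l = range (\<lambda>n::int. l powi n)"

text \<open>
  By the Schwarz--Pick inequality, composition with a holomorphic self-map of the disk maps the
  Bloch space to itself. Hence the supremum in the isometry condition is always that of a bounded
  set, and an isometric composition operator is a bounded operator.
\<close>

lemma schwarz_pick_deriv:
  assumes hol: "\<phi> holomorphic_on ball 0 1" and im: "\<phi> ` ball 0 1 \<subseteq> ball 0 1"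
    and a: "a \<in> ball 0 1"
  shows "(1 - (cmod a)\<^sup>2) * cmod (deriv \<phi> a) \<le> 1 - (cmod (\<phi> a))\<^sup>2"
proof -
  let ?b = "\<phi> a"
  let ?M = "Moebius_function 0 (- a)" and ?N = "Moebius_function 0 ?b"
  have "?b \<in> ball 0 1" using a im by blast
  then have na: "cmod a < 1" and nb: "cmod ?b < 1" using a by simp_all
  have pa: "1 - (cmod a)\<^sup>2 > 0" and pb: "1 - (cmod ?b)\<^sup>2 > 0"
    using na nb by (simp_all add: power2_eq_square mult_less_cancel_left1 abs_square_less_1 flip: power2_eq_square)
  have M0: "?M 0 = a" by (simp add: Moebius_function_of_zero)
  have Mball: "?M z \<in> ball 0 1" if "z \<in> ball 0 1" for z
    using Moebius_function_norm_lt_1[of "- a" z 0] na that by simp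
  have dM: "(?M has_field_derivative of_real (1 - (cmod a)\<^sup>2)) (at 0)"
    unfolding Moebius_function_def complex_norm_square of_real_diff
    by (rule derivative_eq_intros refl | simp)+
  have sq: "?b * cnj ?b = of_real ((cmod ?b)\<^sup>2)"
    by (simp only: complex_norm_square)
  have nz: "1 - cnj ?b * ?b \<noteq> 0"
    using pb by (metis mult.commute of_real_1 of_real_eq_iff less_irrefl right_minus_eq sq)
  have "(?N has_field_derivative
      ((1 - cnj ?b * ?b) / ((1 - cnj ?b * ?b) * (1 - cnj ?b * ?b)))) (at ?b)"
    unfolding Moebius_function_def using nz
    by (auto intro!: derivative_eq_intros)
  moreover have "(1 - cnj ?b * ?b) / ((1 - cnj ?b * ?b) * (1 - cnj ?b * ?b))
      = of_real (1 / (1 - (cmod ?b)\<^sup>2))"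
    using nz sq by (simp add: mult.commute)
  ultimately have dN: "(?N has_field_derivative of_real (1 / (1 - (cmod ?b)\<^sup>2))) (at ?b)"
    by metis
  have dphi: "(\<phi> has_field_derivative deriv \<phi> a) (at a)"
    using holomorphic_derivI[OF hol open_ball a] .
  define h where "h = (\<lambda>z. ?N (\<phi> (?M z)))"
  have dpM: "((\<lambda>z. \<phi> (?M z)) has_field_derivative deriv \<phi> a * of_real (1 - (cmod a)\<^sup>2)) (at 0)"
    by (rule DERIV_chain2[where g = ?M]) (simp_all only: M0 dphi dM)
  have "(h has_field_derivative of_real (1 / (1 - (cmod ?b)\<^sup>2)) *
      (deriv \<phi> a * of_real (1 - (cmod a)\<^sup>2))) (at 0)"
    unfolding h_def
    by (rule DERIV_chain2[where g = "\<lambda>z. \<phi> (?M z)"]) (simp_all only: M0 dN dpM)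
  then have dh: "deriv h 0 = of_real (1 / (1 - (cmod ?b)\<^sup>2)) * (deriv \<phi> a * of_real (1 - (cmod a)\<^sup>2))"
    by (rule DERIV_imp_deriv)
  have holM: "?M holomorphic_on ball 0 1" and holN: "?N holomorphic_on ball 0 1"
    using na nb by (simp_all add: Moebius_function_holomorphic)
  have "(\<phi> \<circ> ?M) holomorphic_on ball 0 1"
    by (rule holomorphic_on_compose_gen[OF holM hol]) (use Mball in blast)
  then have "(?N \<circ> (\<phi> \<circ> ?M)) holomorphic_on ball 0 1"
    by (rule holomorphic_on_compose_gen[OF _ holN]) (use Mball im in fastforce)
  then have "h holomorphic_on ball 0 1"
    by (simp add: h_def o_def)
  moreover have "h 0 = 0"
    by (simp add: h_def M0 Moebius_function_eq_zero)
  moreover have "norm (h z) < 1" if "norm z < 1" for z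
  proof -
    have "?M z \<in> ball 0 1"
      using Mball that by simp
    then have "\<phi> (?M z) \<in> ball 0 1" using im by blast
    then have "norm (\<phi> (?M z)) < 1" by simp
    then show ?thesis unfolding h_def by (rule Moebius_function_norm_lt_1[OF nb])
  qed
  ultimately have "norm (deriv h 0) \<le> 1"
    using Schwarz_Lemma(2)[of h 0] by simp
  then have "(1 / (1 - (cmod ?b)\<^sup>2)) * (cmod (deriv \<phi> a) * (1 - (cmod a)\<^sup>2)) \<le> 1"
    unfolding dh norm_mult norm_of_real using pa pb by simp
  then show ?thesis using pb by (simp add: field_simps)
qed

lemma composition_operator_in_bloch_space:
  assumes hol: "\<phi> holomorphic_on ball 0 1" and im: "\<phi> ` ball 0 1 \<subseteq> ball 0 1"
    and f: "f \<in> bloch_space"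
  shows "composition_operator \<phi> f \<in> bloch_space"
proof -
  let ?C = "composition_operator \<phi> f"
  have holf: "f holomorphic_on ball 0 1" using f by (simp add: bloch_space_def)
  have "(f \<circ> \<phi>) holomorphic_on ball 0 1"
    by (rule holomorphic_on_compose_gen[OF hol holf im])
  then have holC: "?C holomorphic_on ball 0 1"
    by (rule holomorphic_transform) (simp add: composition_operator_def)
  obtain B where B: "(1 - (cmod w)\<^sup>2) * cmod (deriv f w) \<le> B" if "w \<in> ball 0 1" for w
    using f unfolding bloch_space_def bdd_above_def by blast
  have "(1 - (cmod z)\<^sup>2) * cmod (deriv ?C z) \<le> B" if z: "z \<in> ball 0 1" for z
  proof -
    have fz: "\<phi> z \<in> ball 0 1" using im z by blast
    have "((\<lambda>z. f (\<phi> z)) has_field_derivative deriv f (\<phi> z) * deriv \<phi> z) (at z)"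
      by (rule DERIV_chain2[OF holomorphic_derivI[OF holf open_ball fz]
            holomorphic_derivI[OF hol open_ball z]])
    then have "(?C has_field_derivative deriv f (\<phi> z) * deriv \<phi> z) (at z)"
      by (rule has_field_derivative_transform_within_open[OF _ open_ball z])
        (simp add: composition_operator_def)
    then have "deriv ?C z = deriv f (\<phi> z) * deriv \<phi> z"
      by (rule DERIV_imp_deriv)
    then have "(1 - (cmod z)\<^sup>2) * cmod (deriv ?C z)
        = ((1 - (cmod z)\<^sup>2) * cmod (deriv \<phi> z)) * cmod (deriv f (\<phi> z))"
      by (simp add: norm_mult)
    also have "\<dots> \<le> (1 - (cmod (\<phi> z))\<^sup>2) * cmod (deriv f (\<phi> z))"
      by (rule mult_right_mono[OF schwarz_pick_deriv[OF hol im z] norm_ge_zero])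
    also have "\<dots> \<le> B" by (rule B[OF fz])
    finally show ?thesis .
  qed
  then have "bdd_above ((\<lambda>z. (1 - (cmod z)\<^sup>2) * cmod (deriv ?C z)) ` ball 0 1)"
    unfolding bdd_above_def by blast
  moreover have "\<forall>z. z \<notin> ball 0 1 \<longrightarrow> ?C z = 0"
    by (simp add: composition_operator_def)
  ultimately show ?thesis
    using holC unfolding bloch_space_def by blast
qed

lemma bloch_bounded_operator_composition:
  assumes "\<phi> holomorphic_on ball 0 1" and "\<phi> ` ball 0 1 \<subseteq> ball 0 1"
    and "bloch_isometry (composition_operator \<phi>)"
  shows "bloch_bounded_operator (composition_operator \<phi>)"
  unfolding bloch_bounded_operator_def
proof (intro conjI ballI allI exI[of _ 1])
  show "composition_operator \<phi> f \<in> bloch_space" if "f \<in> bloch_space" for f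
    by (rule composition_operator_in_bloch_space[OF assms(1,2) that])
  show "bloch_norm (composition_operator \<phi> f) \<le> 1 * bloch_norm f" if "f \<in> bloch_space" for f
    using assms(3) that by (simp add: bloch_isometry_def)
qed (simp_all add: composition_operator_def fun_eq_iff)

end

theory Submission
  imports Defs
begin

text \<open>
  Write $T = C_\<phi>$, a linear isometry of the Bloch space, and call $\<mu>$ onto if $T - \<mu>$ is
  surjective. Since $\<bar>1 - |\<mu>|\<bar> ||f|| \<le> ||T f - \<mu> f||$, the operator $T - \<mu>$
  is bounded below for every $\<mu>$ off the unit circle, and such a $\<mu>$ belongs to the spectrum
  exactly if it is not onto. The contraction principle in the complete Bloch space shows that every
  $\<mu>$ with $|\<mu>| > 1$ is onto and that being onto is stable under perturbations smaller than
  the lower bound. Inside the disk this makes being onto locally constant, so by connectedness the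
  disk consists of spectrum if $T$ is not surjective, and is free of spectrum if $T$ is surjective.
  The spectrum is closed, so it is the closed disk in the first case and a subset of the circle in the
  second (\<open>isometry_spectrum_not_onto\<close>, \<open>isometry_spectrum_onto\<close>).

  It remains to see that $T$ is surjective only for rotations (\<open>isometric_onto_imp_rotation\<close>).
  Testing the isometry on $z + c$ for two constants $c$ gives $\<phi>(0) = 0$, so $T$ preserves the
  seminorm $\<beta>$. If $T$ is surjective, the identity of the disk is $g \<circ> \<phi>$ with
  $\<beta>_g = \<beta>_z = 1$; then $|g'(0)| \<le> 1$ and $g'(0) \<phi>'(0) = 1$ force
  $|\<phi>'(0)| = 1$, the equality case of the Schwarz lemma.

  For a rotation by $\<lambda>$ the monomials $z^n$ are eigenvectors for $\<lambda>^n$. If $\<lambda>$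
  has infinite order, these eigenvalues are dense in the circle, which contains the spectrum. If
  $\<lambda>$ has order $k$, they are all the $k$-th roots of unity, and there is nothing else in the
  spectrum because $T^k$ is the identity, so that $T - \<mu>$ has an explicit inverse whenever
  $\<mu>^k \<noteq> 1$.
\<close>


section \<open>The Bloch space as a normed space\<close>

lemma bloch_space_holomorphic: "f \<in> bloch_space \<Longrightarrow> f holomorphic_on ball 0 1"
  and bloch_space_outside: "f \<in> bloch_space \<Longrightarrow> z \<notin> ball 0 1 \<Longrightarrow> f z = 0"
  by (auto simp: bloch_space_def)

lemma bloch_spaceI:
  assumes "f holomorphic_on ball 0 1" "\<And>z. z \<notin> ball 0 1 \<Longrightarrow> f z = 0"
    and "\<And>z. z \<in> ball 0 1 \<Longrightarrow> (1 - (cmod z)\<^sup>2) * cmod (deriv f z) \<le> C"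
  shows "f \<in> bloch_space"
  using assms by (auto simp: bloch_space_def intro!: bdd_aboveI2)

lemma deriv_le_bloch_seminorm:
  assumes "f \<in> bloch_space" "z \<in> ball 0 1"
  shows "(1 - (cmod z)\<^sup>2) * cmod (deriv f z) \<le> bloch_seminorm f"
  unfolding bloch_seminorm_def using assms by (intro cSUP_upper) (auto simp: bloch_space_def)

lemma bloch_seminorm_le:
  assumes "\<And>z. z \<in> ball 0 1 \<Longrightarrow> (1 - (cmod z)\<^sup>2) * cmod (deriv f z) \<le> C"
  shows "bloch_seminorm f \<le> C"
  unfolding bloch_seminorm_def using assms by (intro cSUP_least) auto

lemma one_minus_norm_sq_pos: "z \<in> ball 0 1 \<Longrightarrow> 0 < 1 - (cmod z)\<^sup>2"
  by (simp add: abs_square_less_1)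

lemma bloch_seminorm_nonneg: "f \<in> bloch_space \<Longrightarrow> 0 \<le> bloch_seminorm f"
  using deriv_le_bloch_seminorm[of f 0] by (simp add: order_trans[OF norm_ge_zero])

lemma bloch_norm_nonneg: "f \<in> bloch_space \<Longrightarrow> 0 \<le> bloch_norm f"
  by (simp add: bloch_norm_def bloch_seminorm_nonneg)

lemma bloch_lincomb:
  assumes f: "f \<in> bloch_space" and g: "g \<in> bloch_space"
  shows "(\<lambda>z. a * f z + b * g z) \<in> bloch_space" (is ?mem)
    and "bloch_norm (\<lambda>z. a * f z + b * g z) \<le> cmod a * bloch_norm f + cmod b * bloch_norm g"
      (is ?le)
proof -
  let ?h = "\<lambda>z. a * f z + b * g z"
  note hol = bloch_space_holomorphic[OF f] bloch_space_holomorphic[OF g]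
  have bd: "(1 - (cmod z)\<^sup>2) * cmod (deriv ?h z)
      \<le> cmod a * bloch_seminorm f + cmod b * bloch_seminorm g" if z: "z \<in> ball 0 1" for z
  proof -
    have "(?h has_field_derivative a * deriv f z + b * deriv g z) (at z)"
      by (intro DERIV_add DERIV_cmult holomorphic_derivI[OF _ open_ball z] hol)
    then have "cmod (deriv ?h z) \<le> cmod a * cmod (deriv f z) + cmod b * cmod (deriv g z)"
      by (simp add: DERIV_imp_deriv norm_mult[symmetric] norm_triangle_ineq)
    then have "(1 - (cmod z)\<^sup>2) * cmod (deriv ?h z)
        \<le> (1 - (cmod z)\<^sup>2) * (cmod a * cmod (deriv f z) + cmod b * cmod (deriv g z))"
      using one_minus_norm_sq_pos[OF z] by (intro mult_left_mono) auto
    also have "\<dots> = cmod a * ((1 - (cmod z)\<^sup>2) * cmod (deriv f z))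
        + cmod b * ((1 - (cmod z)\<^sup>2) * cmod (deriv g z))"
      by (simp add: algebra_simps)
    also have "\<dots> \<le> cmod a * bloch_seminorm f + cmod b * bloch_seminorm g"
      using z f g by (intro add_mono mult_left_mono deriv_le_bloch_seminorm) auto
    finally show ?thesis .
  qed
  show ?mem
    by (rule bloch_spaceI[OF _ _ bd])
      (use hol f g in \<open>auto intro!: holomorphic_intros simp: bloch_space_outside\<close>)
  have "cmod (?h 0) \<le> cmod a * cmod (f 0) + cmod b * cmod (g 0)"
    by (simp add: norm_mult[symmetric] norm_triangle_ineq)
  moreover have "bloch_seminorm ?h \<le> cmod a * bloch_seminorm f + cmod b * bloch_seminorm g"
    by (rule bloch_seminorm_le[OF bd])
  ultimately show ?le
    by (simp add: bloch_norm_def algebra_simps)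
qed

lemma bloch_space_add: "f \<in> bloch_space \<Longrightarrow> g \<in> bloch_space \<Longrightarrow> (\<lambda>z. f z + g z) \<in> bloch_space"
  and bloch_space_diff: "f \<in> bloch_space \<Longrightarrow> g \<in> bloch_space \<Longrightarrow> (\<lambda>z. f z - g z) \<in> bloch_space"
  and bloch_space_cmult: "f \<in> bloch_space \<Longrightarrow> (\<lambda>z. c * f z) \<in> bloch_space"
  using bloch_lincomb(1)[of f g 1 1] bloch_lincomb(1)[of f g 1 "-1"] bloch_lincomb(1)[of f f c 0]
  by simp_all

lemma bloch_space_zero: "(\<lambda>z. 0) \<in> bloch_space"
  by (rule bloch_spaceI[where C = 0]) auto

lemma bloch_space_sum:
  assumes "\<And>i. i \<in> I \<Longrightarrow> f i \<in> bloch_space"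
  shows "(\<lambda>z. \<Sum>i\<in>I. f i z) \<in> bloch_space"
  using assms
  by (induction I rule: infinite_finite_induct) (auto intro: bloch_space_zero bloch_space_add)

lemma bloch_norm_triangle:
  "f \<in> bloch_space \<Longrightarrow> g \<in> bloch_space \<Longrightarrow> bloch_norm (\<lambda>z. f z + g z) \<le> bloch_norm f + bloch_norm g"
  using bloch_lincomb(2)[of f g 1 1] by simp

lemma bloch_norm_zero: "bloch_norm (\<lambda>z. 0) = 0"
  using bloch_lincomb(2)[OF bloch_space_zero bloch_space_zero, of 0 0]
    bloch_norm_nonneg[OF bloch_space_zero] by simp

lemma bloch_norm_cmult:
  assumes f: "f \<in> bloch_space"
  shows "bloch_norm (\<lambda>z. c * f z) = cmod c * bloch_norm f"
proof (cases "c = 0")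
  case False
  have le: "bloch_norm (\<lambda>z. a * g z) \<le> cmod a * bloch_norm g" if "g \<in> bloch_space" for a g
    using bloch_lincomb(2)[OF that that, of a 0] by simp
  have "(\<lambda>z. inverse c * (c * f z)) = f"
    using False by auto
  then have "bloch_norm f \<le> cmod (inverse c) * bloch_norm (\<lambda>z. c * f z)"
    using le[OF bloch_space_cmult[OF f, of c], of "inverse c"] by simp
  then have "cmod c * bloch_norm f \<le> bloch_norm (\<lambda>z. c * f z)"
    using False by (simp add: norm_inverse inverse_eq_divide norm_divide pos_le_divide_eq mult.commute)
  with le[OF f, of c] show ?thesis by simp
qed (simp add: bloch_norm_zero)

lemma bloch_norm_diff_ge:
  assumes "f \<in> bloch_space" "g \<in> bloch_space"
  shows "bloch_norm f - bloch_norm g \<le> bloch_norm (\<lambda>z. f z - g z)"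
  using bloch_norm_triangle[OF bloch_space_diff[OF assms] assms(2)] by simp

lemma bloch_norm_minus_commute:
  assumes "f \<in> bloch_space" "g \<in> bloch_space"
  shows "bloch_norm (\<lambda>z. f z - g z) = bloch_norm (\<lambda>z. g z - f z)"
  using bloch_norm_cmult[OF bloch_space_diff[OF assms], of "-1"] by simp

lemma bloch_norm_sum_le:
  assumes "\<And>i. i \<in> I \<Longrightarrow> f i \<in> bloch_space"
  shows "bloch_norm (\<lambda>z. \<Sum>i\<in>I. f i z) \<le> (\<Sum>i\<in>I. bloch_norm (f i))"
  using assms
proof (induction I rule: infinite_finite_induct)
  case (insert i I)
  then show ?case
    using bloch_norm_triangle[OF _ bloch_space_sum, of "f i" I f] by fastforce
qed (simp_all add: bloch_norm_zero)

text \<open>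
  Integrate $|f'| \<le> \<beta>_f / (1 - |z|^2)$ along the radius. Thus point evaluations are continuous,
  locally uniformly in the point, and convergence in norm implies locally uniform convergence.
\<close>

lemma norm_le_bloch_norm:
  assumes f: "f \<in> bloch_space" and z: "z \<in> ball 0 1"
  shows "cmod (f z) \<le> bloch_norm f / (1 - (cmod z)\<^sup>2)"
proof -
  let ?B = "bloch_seminorm f / (1 - (cmod z)\<^sup>2)"
  note pos = one_minus_norm_sq_pos[OF z]
  have sub: "cball 0 (cmod z) \<subseteq> ball (0::complex) 1" using z by auto
  have "cmod (f z - f 0) \<le> ?B * cmod (z - 0)"
  proof (rule field_differentiable_bound[of "cball 0 (cmod z)" f "deriv f"])
    fix w :: complex assume w: "w \<in> cball 0 (cmod z)"
    then have wb: "w \<in> ball 0 1" using sub by blast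
    show "(f has_field_derivative deriv f w) (at w within cball 0 (cmod z))"
      using holomorphic_derivI[OF bloch_space_holomorphic[OF f] open_ball wb] .
    have "(1 - (cmod z)\<^sup>2) * cmod (deriv f w) \<le> (1 - (cmod w)\<^sup>2) * cmod (deriv f w)"
      using w by (intro mult_right_mono) (auto simp: power_mono)
    also have "\<dots> \<le> bloch_seminorm f"
      by (rule deriv_le_bloch_seminorm[OF f wb])
    finally show "cmod (deriv f w) \<le> ?B"
      using pos by (simp add: field_simps)
  qed auto
  also have "\<dots> \<le> ?B"
    using z pos bloch_seminorm_nonneg[OF f] by (intro mult_right_le_one_le divide_nonneg_pos) auto
  finally have "cmod (f z) \<le> cmod (f 0) + ?B"
    using norm_triangle_sub[of "f z" "f 0"] by linarith
  also have "cmod (f 0) \<le> cmod (f 0) / (1 - (cmod z)\<^sup>2)"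
    using pos by (simp add: field_simps mult_left_le)
  finally show ?thesis
    by (simp add: bloch_norm_def add_divide_distrib)
qed

lemma bloch_norm_eq_zero_iff:
  assumes "f \<in> bloch_space"
  shows "bloch_norm f = 0 \<longleftrightarrow> f = (\<lambda>z. 0)"
proof
  assume "bloch_norm f = 0"
  then have "f z = 0" for z
    using norm_le_bloch_norm[OF assms, of z] bloch_space_outside[OF assms, of z] by fastforce
  then show "f = (\<lambda>z. 0)" by auto
qed (simp add: bloch_norm_zero)


section \<open>Completeness\<close>

text \<open>
  A \<^locale>\<open>Metric_space\<close> wants its distance nonnegative and symmetric on the whole type; the
  norm of a difference need not be either for functions outside the Bloch space, hence the value 0 there.
\<close>

definition bloch_dist :: "(complex \<Rightarrow> complex) \<Rightarrow> (complex \<Rightarrow> complex) \<Rightarrow> real" where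
  "bloch_dist f g =
     (if f \<in> bloch_space \<and> g \<in> bloch_space then bloch_norm (\<lambda>z. f z - g z) else 0)"

lemma Metric_space_bloch: "Metric_space bloch_space bloch_dist"
proof
  show "0 \<le> bloch_dist f g" for f g
    by (simp add: bloch_dist_def bloch_norm_nonneg bloch_space_diff)
  show "bloch_dist f g = bloch_dist g f" for f g
    using bloch_norm_minus_commute[of f g] by (auto simp: bloch_dist_def)
  show "bloch_dist f g = 0 \<longleftrightarrow> f = g" if "f \<in> bloch_space" "g \<in> bloch_space" for f g
    using that by (simp add: bloch_dist_def bloch_norm_eq_zero_iff bloch_space_diff fun_eq_iff)
  show "bloch_dist f h \<le> bloch_dist f g + bloch_dist g h"
    if "f \<in> bloch_space" "g \<in> bloch_space" "h \<in> bloch_space" for f g h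
    using that bloch_norm_triangle[OF bloch_space_diff bloch_space_diff, of f g g h]
    by (simp add: bloch_dist_def)
qed

text \<open>
  A Cauchy sequence converges locally uniformly, by continuity of point evaluations, so its limit is
  analytic and the derivatives converge pointwise. That is enough to carry the Cauchy estimates over
  to the limit, since each of them concerns a single point.
\<close>

lemma mcomplete_bloch: "Metric_space.mcomplete bloch_space bloch_dist"
proof -
  interpret Metric_space bloch_space bloch_dist by (rule Metric_space_bloch)
  show ?thesis
    unfolding mcomplete_def
  proof (intro allI impI)
    fix F assume "MCauchy F"
    then have F: "F n \<in> bloch_space"
      and cauchy: "\<And>e. e > 0 \<Longrightarrow> \<exists>N. \<forall>m n. N \<le> m \<longrightarrow> N \<le> n \<longrightarrow> bloch_norm (\<lambda>z. F m z - F n z) < e" for n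
      by (auto simp: MCauchy_def bloch_dist_def image_subset_iff)
    have "uniformly_Cauchy_on (cball 0 r) F" if r: "r < 1" for r
      unfolding uniformly_Cauchy_on_def
    proof (intro allI impI)
      fix e :: real assume e: "e > 0"
      show "\<exists>M. \<forall>z\<in>cball 0 r. \<forall>m\<ge>M. \<forall>n\<ge>M. dist (F m z) (F n z) < e"
      proof (cases "r < 0")
        case False
        then have r2: "0 < 1 - r\<^sup>2" using r by (simp add: abs_square_less_1)
        obtain N where N: "\<And>m n. N \<le> m \<Longrightarrow> N \<le> n \<Longrightarrow> bloch_norm (\<lambda>z. F m z - F n z) < e * (1 - r\<^sup>2)"
          using cauchy[of "e * (1 - r\<^sup>2)"] e r2 by auto
        have "dist (F m z) (F n z) < e" if z: "z \<in> cball 0 r" and mn: "m \<ge> N" "n \<ge> N" for z m n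
        proof -
          have zb: "z \<in> ball 0 1" using z r by auto
          have "cmod (F m z - F n z) \<le> bloch_norm (\<lambda>z. F m z - F n z) / (1 - (cmod z)\<^sup>2)"
            by (rule norm_le_bloch_norm[OF bloch_space_diff[OF F F] zb])
          also have "\<dots> \<le> bloch_norm (\<lambda>z. F m z - F n z) / (1 - r\<^sup>2)"
            using z r2 one_minus_norm_sq_pos[OF zb]
            by (intro divide_left_mono bloch_norm_nonneg[OF bloch_space_diff[OF F F]])
              (auto simp: power_mono)
          also have "\<dots> < e"
            using N[OF mn] r2 by (simp add: pos_divide_less_eq)
          finally show ?thesis by (simp add: dist_norm)
        qed
        then show ?thesis by blast
      qed auto
    qed
    then have unif: "uniform_limit (cball 0 r) F (\<lambda>z. lim (\<lambda>n. F n z)) sequentially" if "r < 1" for r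
      using that Cauchy_uniformly_convergent uniformly_convergent_uniform_limit_iff by blast
    define g where "g = (\<lambda>z. lim (\<lambda>n. F n z))"
    have unif_g: "uniform_limit (cball 0 r) F g sequentially" if "r < 1" for r
      using unif[OF that] by (simp add: g_def)
    have hol_F: "F n holomorphic_on ball 0 1" for n
      by (rule bloch_space_holomorphic[OF F])
    have hol_g: "g holomorphic_on ball 0 1"
    proof (rule holomorphic_uniform_sequence[OF open_ball hol_F])
      fix z :: complex assume z: "z \<in> ball 0 1"
      define d where "d = (1 - cmod z) / 2"
      have "cball z d \<subseteq> cball 0 (cmod z + d)"
        by (auto simp: dist_norm) (metis add.commute diff_add_cancel norm_minus_commute
            norm_triangle_ineq2 add_le_cancel_right order_trans diff_le_eq)
      moreover have "cmod z + d < 1" "d > 0" using z by (auto simp: d_def field_simps)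
      ultimately show "\<exists>d>0. cball z d \<subseteq> ball 0 1 \<and> uniform_limit (cball z d) F g sequentially"
        by (intro exI[of _ d] conjI uniform_limit_on_subset[OF unif_g]) auto
    qed
    have lim_g: "(\<lambda>n. F n z) \<longlonglongrightarrow> g z" if "z \<in> ball 0 1" for z
      using that by (intro tendsto_uniform_limitI[OF unif_g[of "cmod z"]]) auto
    have lim_dg: "(\<lambda>n. deriv (F n) z) \<longlonglongrightarrow> deriv g z" if z: "z \<in> ball 0 1" for z
    proof -
      obtain r where r: "cmod z < r" "r < 1" using z dense by auto
      have "uniform_limit (ball 0 r) F g sequentially"
        by (rule uniform_limit_on_subset[OF unif_g[OF r(2)] ball_subset_cball])
      then show ?thesis
        by (rule deriv_complex_uniform_limit)
          (use r in \<open>auto intro!: holomorphic_on_subset[OF hol_F] always_eventually\<close>)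
    qed
    have g_out: "g z = 0" if "z \<notin> ball 0 1" for z
      using bloch_space_outside[OF F that] by (simp add: g_def)
    \<comment> \<open>Pass to the limit in the pointwise estimates that define the norm.\<close>
    have bound: "(1 - (cmod z)\<^sup>2) * cmod (deriv (\<lambda>z. F n z - g z) z) + cmod (F n 0 - g 0) \<le> e"
      if tail: "\<And>m. m \<ge> N \<Longrightarrow> bloch_norm (\<lambda>z. F n z - F m z) < e" and z: "z \<in> ball 0 1" for N n e z
    proof (rule tendsto_upperbound)
      have dd: "deriv (\<lambda>z. F n z - h z) z = deriv (F n) z - deriv h z" if "h holomorphic_on ball 0 1" for h
        by (intro DERIV_imp_deriv DERIV_diff holomorphic_derivI[OF _ open_ball z] hol_F that)
      show "(\<lambda>m. (1 - (cmod z)\<^sup>2) * cmod (deriv (\<lambda>z. F n z - F m z) z) + cmod (F n 0 - F m 0))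
          \<longlonglongrightarrow> (1 - (cmod z)\<^sup>2) * cmod (deriv (\<lambda>z. F n z - g z) z) + cmod (F n 0 - g 0)"
        unfolding dd[OF hol_F] dd[OF hol_g]
        by (intro tendsto_intros lim_dg lim_g) (use z in auto)
      show "\<forall>\<^sub>F m in sequentially. (1 - (cmod z)\<^sup>2) * cmod (deriv (\<lambda>z. F n z - F m z) z) + cmod (F n 0 - F m 0) \<le> e"
      proof (rule eventually_sequentiallyI[of N])
        fix m assume "m \<ge> N"
        from tail[OF this] deriv_le_bloch_seminorm[OF bloch_space_diff[OF F F] z, of n m]
        show "(1 - (cmod z)\<^sup>2) * cmod (deriv (\<lambda>z. F n z - F m z) z) + cmod (F n 0 - F m 0) \<le> e"
          by (simp add: bloch_norm_def)
      qed
    qed simp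
    obtain N1 where N1: "\<And>m n. N1 \<le> m \<Longrightarrow> N1 \<le> n \<Longrightarrow> bloch_norm (\<lambda>z. F m z - F n z) < 1"
      using cauchy[of 1] by auto
    \<comment> \<open>The limit lies in the space because its distance from one member is finite.\<close>
    have "(\<lambda>z. F N1 z - g z) \<in> bloch_space"
    proof (rule bloch_spaceI[where C = 1])
      show "(\<lambda>z. F N1 z - g z) holomorphic_on ball 0 1"
        by (intro holomorphic_intros hol_F hol_g)
      show "(1 - (cmod z)\<^sup>2) * cmod (deriv (\<lambda>z. F N1 z - g z) z) \<le> 1" if "z \<in> ball 0 1" for z
        using bound[of N1 N1 1 z, OF N1 that] norm_ge_zero[of "F N1 0 - g 0"] by linarith
    qed (simp add: g_out bloch_space_outside[OF F])
    from bloch_space_diff[OF F[of N1] this] have g: "g \<in> bloch_space"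
      by simp
    have "\<exists>N. \<forall>n\<ge>N. F n \<in> bloch_space \<and> bloch_dist (F n) g < e" if "e > 0" for e
    proof -
      obtain N where N: "\<And>m n. N \<le> m \<Longrightarrow> N \<le> n \<Longrightarrow> bloch_norm (\<lambda>z. F m z - F n z) < e / 2"
        using cauchy[of "e / 2"] \<open>e > 0\<close> by auto
      have "bloch_norm (\<lambda>z. F n z - g z) \<le> e / 2" if n: "n \<ge> N" for n
      proof -
        have "bloch_seminorm (\<lambda>z. F n z - g z) \<le> e / 2 - cmod (F n 0 - g 0)"
        proof (rule bloch_seminorm_le)
          fix z :: complex assume z: "z \<in> ball 0 1"
          from bound[of N n "e / 2" z, OF N[OF n] z]
          show "(1 - (cmod z)\<^sup>2) * cmod (deriv (\<lambda>z. F n z - g z) z) \<le> e / 2 - cmod (F n 0 - g 0)"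
            by simp
        qed
        then show ?thesis by (simp add: bloch_norm_def)
      qed
      then have "bloch_norm (\<lambda>z. F n z - g z) < e" if "n \<ge> N" for n
        using that \<open>e > 0\<close> by fastforce
      then show ?thesis
        using F g by (auto simp: bloch_dist_def)
    qed
    with g show "\<exists>g. limitin mtopology F g sequentially"
      by (auto simp: limit_metric_sequentially)
  qed
qed


section \<open>Bounded operators and their resolvents\<close>

context
  fixes T :: "(complex \<Rightarrow> complex) \<Rightarrow> complex \<Rightarrow> complex"
  assumes T: "bloch_bounded_operator T"
begin

lemma bloch_op_closed: "f \<in> bloch_space \<Longrightarrow> T f \<in> bloch_space"
  and bloch_op_add: "f \<in> bloch_space \<Longrightarrow> g \<in> bloch_space \<Longrightarrow> T (\<lambda>z. f z + g z) = (\<lambda>z. T f z + T g z)"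
  and bloch_op_cmult: "f \<in> bloch_space \<Longrightarrow> T (\<lambda>z. c * f z) = (\<lambda>z. c * T f z)"
  using T by (auto simp: bloch_bounded_operator_def)

lemma bloch_op_diff:
  assumes "f \<in> bloch_space" "g \<in> bloch_space"
  shows "T (\<lambda>z. f z - g z) = (\<lambda>z. T f z - T g z)"
  using bloch_op_add[OF assms(1) bloch_space_cmult[OF assms(2), of "-1"]]
    bloch_op_cmult[OF assms(2), of "-1"] by simp

lemma bloch_op_shift_closed: "f \<in> bloch_space \<Longrightarrow> (\<lambda>z. T f z - \<mu> * f z) \<in> bloch_space"
  by (intro bloch_space_diff bloch_space_cmult bloch_op_closed)

end

definition shift_bounded_below ::
    "((complex \<Rightarrow> complex) \<Rightarrow> (complex \<Rightarrow> complex)) \<Rightarrow> complex \<Rightarrow> real \<Rightarrow> bool" where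
  "shift_bounded_below T \<mu> c \<longleftrightarrow>
     (\<forall>f\<in>bloch_space. c * bloch_norm f \<le> bloch_norm (\<lambda>z. T f z - \<mu> * f z))"

definition shift_onto ::
    "((complex \<Rightarrow> complex) \<Rightarrow> (complex \<Rightarrow> complex)) \<Rightarrow> complex \<Rightarrow> bool" where
  "shift_onto T \<mu> \<longleftrightarrow> (\<forall>g\<in>bloch_space. \<exists>f\<in>bloch_space. (\<lambda>z. T f z - \<mu> * f z) = g)"

text \<open>
  The inverse is bounded because the operator is bounded below, and linear because it inverts a
  linear bijection; so only a set-theoretic inverse has to be chosen.
\<close>

lemma not_in_bloch_spectrum_iff:
  assumes T: "bloch_bounded_operator T"
  shows "\<mu> \<notin> bloch_spectrum T \<longleftrightarrow> (\<exists>c>0. shift_bounded_below T \<mu> c) \<and> shift_onto T \<mu>"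
    (is "?L \<longleftrightarrow> ?R")
proof
  let ?A = "\<lambda>f z. T f z - \<mu> * f z"
  assume ?L
  then obtain S where S: "bloch_bounded_operator S"
    and SA: "\<And>f. f \<in> bloch_space \<Longrightarrow> S (?A f) = f"
    and AS: "\<And>f. f \<in> bloch_space \<Longrightarrow> ?A (S f) = f"
    unfolding bloch_spectrum_def by blast
  obtain K where K: "\<And>f. f \<in> bloch_space \<Longrightarrow> bloch_norm (S f) \<le> K * bloch_norm f"
    using S unfolding bloch_bounded_operator_def by blast
  \<comment> \<open>The bound for the inverse may be zero or negative, so it is raised to at least 1 before inverting.\<close>
  define c where "c = inverse (max K 1)"
  have "c * bloch_norm f \<le> bloch_norm (?A f)" if f: "f \<in> bloch_space" for f
  proof -
    note Af = bloch_op_shift_closed[OF T f, of \<mu>]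
    have "bloch_norm f \<le> K * bloch_norm (?A f)"
      using K[OF Af] by (simp add: SA f)
    also have "\<dots> \<le> max K 1 * bloch_norm (?A f)"
      by (intro mult_right_mono bloch_norm_nonneg[OF Af]) simp
    finally show ?thesis
      by (simp add: c_def field_simps)
  qed
  then have "shift_bounded_below T \<mu> c"
    by (simp add: shift_bounded_below_def)
  moreover have "c > 0" by (simp add: c_def)
  moreover have "shift_onto T \<mu>"
    unfolding shift_onto_def using AS bloch_op_closed[OF S] by blast
  ultimately show ?R by blast
next
  let ?A = "\<lambda>f z. T f z - \<mu> * f z"
  assume ?R
  then obtain c where c: "c > 0" and "shift_bounded_below T \<mu> c" and "shift_onto T \<mu>"
    by blast
  then have below: "\<And>f. f \<in> bloch_space \<Longrightarrow> c * bloch_norm f \<le> bloch_norm (?A f)"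
    and onto: "\<And>g. g \<in> bloch_space \<Longrightarrow> \<exists>f. f \<in> bloch_space \<and> ?A f = g"
    by (simp_all add: shift_bounded_below_def shift_onto_def Bex_def)
  have inj: "f = g" if "f \<in> bloch_space" "g \<in> bloch_space" "?A f = ?A g" for f g
  proof -
    have "?A (\<lambda>z. f z - g z) = (\<lambda>z. ?A f z - ?A g z)"
      by (simp add: bloch_op_diff[OF T that(1,2)] algebra_simps)
    also have "\<dots> = (\<lambda>z. 0)" using that(3) by (simp add: fun_eq_iff)
    finally have "c * bloch_norm (\<lambda>z. f z - g z) \<le> 0"
      using below[OF bloch_space_diff[OF that(1,2)]] by (simp add: bloch_norm_zero)
    then have "bloch_norm (\<lambda>z. f z - g z) = 0"
      using c bloch_norm_nonneg[OF bloch_space_diff[OF that(1,2)]]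
      by (simp add: mult_le_0_iff)
    then show ?thesis
      by (simp add: bloch_norm_eq_zero_iff bloch_space_diff that(1,2) fun_eq_iff)
  qed
  have "\<exists>S. \<forall>g\<in>bloch_space. S g \<in> bloch_space \<and> ?A (S g) = g"
    using onto by (intro bchoice ballI)
  then obtain S where Sc: "\<And>g. g \<in> bloch_space \<Longrightarrow> S g \<in> bloch_space"
    and AS: "\<And>g. g \<in> bloch_space \<Longrightarrow> ?A (S g) = g"
    by blast
  have AS_at: "T (S g) z - \<mu> * S g z = g z" if "g \<in> bloch_space" for g z
    using fun_cong[OF AS[OF that]] .
  have SA: "S (?A f) = f" if "f \<in> bloch_space" for f
    by (rule inj[OF Sc that AS]; rule bloch_op_shift_closed[OF T that])
  have "S (\<lambda>z. f z + g z) = (\<lambda>z. S f z + S g z)" if "f \<in> bloch_space" "g \<in> bloch_space" for f g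
  proof (rule inj)
    have "?A (\<lambda>z. S f z + S g z) = (\<lambda>z. ?A (S f) z + ?A (S g) z)"
      unfolding bloch_op_add[OF T Sc[OF that(1)] Sc[OF that(2)]] by (simp add: algebra_simps)
    also have "\<dots> = ?A (S (\<lambda>z. f z + g z))"
      unfolding AS[OF bloch_space_add[OF that]] AS_at[OF that(1)] AS_at[OF that(2)] by (rule refl)
    finally show "?A (S (\<lambda>z. f z + g z)) = ?A (\<lambda>z. S f z + S g z)" by (rule sym)
  qed (use that in \<open>auto intro: Sc bloch_space_add\<close>)
  moreover have "S (\<lambda>z. a * f z) = (\<lambda>z. a * S f z)" if "f \<in> bloch_space" for a f
  proof (rule inj)
    have "?A (\<lambda>z. a * S f z) = (\<lambda>z. a * ?A (S f) z)"
      unfolding bloch_op_cmult[OF T Sc[OF that]] by (simp add: algebra_simps)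
    also have "\<dots> = ?A (S (\<lambda>z. a * f z))"
      unfolding AS[OF bloch_space_cmult[OF that]] AS_at[OF that] by (rule refl)
    finally show "?A (S (\<lambda>z. a * f z)) = ?A (\<lambda>z. a * S f z)" by (rule sym)
  qed (use that in \<open>auto intro: Sc bloch_space_cmult\<close>)
  moreover have "bloch_norm (S f) \<le> inverse c * bloch_norm f" if "f \<in> bloch_space" for f
    using below[OF Sc[OF that]] c unfolding AS[OF that] by (simp add: field_simps)
  ultimately have "bloch_bounded_operator S"
    unfolding bloch_bounded_operator_def using Sc by blast
  then show ?L
    unfolding bloch_spectrum_def using SA AS by blast
qed

text \<open>
  Solving $(T - \<nu>) f = g$ amounts to finding a fixed point of
  $f \<mapsto> (T - \<mu>)^{-1} (g + (\<nu> - \<mu>) f)$, a contraction with constant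
  $|\<nu> - \<mu>| / c < 1$ because the inverse has norm at most $1 / c$.
\<close>

lemma shift_onto_perturb:
  assumes T: "bloch_bounded_operator T"
    and below: "shift_bounded_below T \<mu> c" and onto: "shift_onto T \<mu>" and close: "cmod (\<nu> - \<mu>) < c"
  shows "shift_onto T \<nu>"
  unfolding shift_onto_def
proof
  fix g assume g: "g \<in> bloch_space"
  interpret Metric_space bloch_space bloch_dist by (rule Metric_space_bloch)
  have c: "c > 0" using close norm_ge_zero[of "\<nu> - \<mu>"] by linarith
  have rhs: "(\<lambda>z. g z + (\<nu> - \<mu>) * f z) \<in> bloch_space" if "f \<in> bloch_space" for f
    by (intro bloch_space_add bloch_space_cmult g that)
  from onto have "\<forall>f. \<exists>h. f \<in> bloch_space \<longrightarrow> h \<in> bloch_space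
      \<and> (\<lambda>z. T h z - \<mu> * h z) = (\<lambda>z. g z + (\<nu> - \<mu>) * f z)"
    unfolding shift_onto_def using rhs by meson
  then obtain \<Phi> where \<Phi>: "\<And>f. f \<in> bloch_space \<Longrightarrow> \<Phi> f \<in> bloch_space"
    and eq: "\<And>f. f \<in> bloch_space \<Longrightarrow>
      (\<lambda>z. T (\<Phi> f) z - \<mu> * \<Phi> f z) = (\<lambda>z. g z + (\<nu> - \<mu>) * f z)"
    by metis
  have contract: "bloch_dist (\<Phi> f) (\<Phi> h) \<le> cmod (\<nu> - \<mu>) / c * bloch_dist f h"
    if f: "f \<in> bloch_space" and h: "h \<in> bloch_space" for f h
  proof -
    let ?d = "\<lambda>z. \<Phi> f z - \<Phi> h z"
    note d = bloch_space_diff[OF \<Phi>[OF f] \<Phi>[OF h]]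
    have "(\<lambda>z. T ?d z - \<mu> * ?d z) = (\<lambda>z. (\<nu> - \<mu>) * (f z - h z))"
    proof
      fix z
      have Tz: "T (\<Phi> k) z = g z + (\<nu> - \<mu>) * k z + \<mu> * \<Phi> k z" if "k \<in> bloch_space" for k
        using fun_cong[OF eq[OF that], of z] by (simp add: diff_eq_eq)
      show "T ?d z - \<mu> * ?d z = (\<nu> - \<mu>) * (f z - h z)"
        unfolding bloch_op_diff[OF T \<Phi>[OF f] \<Phi>[OF h]] Tz[OF f] Tz[OF h]
        by (simp add: algebra_simps)
    qed
    then have "c * bloch_norm ?d \<le> cmod (\<nu> - \<mu>) * bloch_norm (\<lambda>z. f z - h z)"
      using below d bloch_norm_cmult[OF bloch_space_diff[OF f h], of "\<nu> - \<mu>"]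
      by (fastforce simp: shift_bounded_below_def)
    then show ?thesis
      using c f h \<Phi> by (simp add: bloch_dist_def pos_le_divide_eq mult.commute)
  qed
  have "cmod (\<nu> - \<mu>) / c < 1" using close c by simp
  then obtain f where f: "f \<in> bloch_space" "\<Phi> f = f"
    using Banach_fixedpoint_thm[OF mcomplete_bloch _ _ _ contract] \<Phi> bloch_space_zero
    by (metis Pi_I emptyE)
  show "\<exists>f\<in>bloch_space. (\<lambda>z. T f z - \<nu> * f z) = g"
  proof
    show "(\<lambda>z. T f z - \<nu> * f z) = g"
      using fun_cong[OF eq[OF f(1)]] by (simp add: f(2) fun_eq_iff algebra_simps)
  qed (rule f(1))
qed

text \<open>
  Together with \<open>shift_onto_perturb\<close> this makes the resolvent set open.
\<close>

lemma shift_bounded_below_perturb: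
  assumes T: "bloch_bounded_operator T" and below: "shift_bounded_below T \<mu> c"
  shows "shift_bounded_below T \<nu> (c - cmod (\<nu> - \<mu>))"
  unfolding shift_bounded_below_def
proof
  fix f assume f: "f \<in> bloch_space"
  have "c * bloch_norm f \<le> bloch_norm (\<lambda>z. T f z - \<mu> * f z)"
    using below f by (simp add: shift_bounded_below_def)
  also have "(\<lambda>z. T f z - \<mu> * f z) = (\<lambda>z. (T f z - \<nu> * f z) + (\<nu> - \<mu>) * f z)"
    by (simp add: algebra_simps)
  also have "bloch_norm \<dots> \<le> bloch_norm (\<lambda>z. T f z - \<nu> * f z) + cmod (\<nu> - \<mu>) * bloch_norm f"
    using bloch_norm_triangle[OF bloch_op_shift_closed[OF T f, of \<nu>] bloch_space_cmult[OF f, of "\<nu> - \<mu>"]]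
    by (simp add: bloch_norm_cmult f)
  finally show "(c - cmod (\<nu> - \<mu>)) * bloch_norm f \<le> bloch_norm (\<lambda>z. T f z - \<nu> * f z)"
    by (simp add: algebra_simps)
qed

lemma closed_bloch_spectrum:
  assumes T: "bloch_bounded_operator T"
  shows "closed (bloch_spectrum T)"
  unfolding closed_def open_contains_ball
proof
  fix \<mu> assume "\<mu> \<in> - bloch_spectrum T"
  then obtain c where c: "c > 0" and below: "shift_bounded_below T \<mu> c" and onto: "shift_onto T \<mu>"
    using not_in_bloch_spectrum_iff[OF T] by auto
  have "ball \<mu> c \<subseteq> - bloch_spectrum T"
  proof
    fix \<nu> assume "\<nu> \<in> ball \<mu> c"
    then have "cmod (\<nu> - \<mu>) < c" by (simp add: dist_norm norm_minus_commute)
    then have "\<nu> \<notin> bloch_spectrum T"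
      using shift_onto_perturb[OF T below onto] shift_bounded_below_perturb[OF T below, of \<nu>]
      by (auto simp: not_in_bloch_spectrum_iff[OF T] intro!: exI[of _ "c - cmod (\<nu> - \<mu>)"])
    then show "\<nu> \<in> - bloch_spectrum T" by simp
  qed
  with c show "\<exists>e>0. ball \<mu> e \<subseteq> - bloch_spectrum T" by blast
qed

lemma eigenvalue_in_bloch_spectrum:
  assumes T: "bloch_bounded_operator T" and f: "f \<in> bloch_space" "f \<noteq> (\<lambda>z. 0)"
    and eig: "T f = (\<lambda>z. \<mu> * f z)"
  shows "\<mu> \<in> bloch_spectrum T"
proof (rule ccontr)
  assume "\<mu> \<notin> bloch_spectrum T"
  then obtain c where c: "c > 0" and below: "shift_bounded_below T \<mu> c"
    using not_in_bloch_spectrum_iff[OF T] by auto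
  have "c * bloch_norm f \<le> 0"
    using below f(1) by (auto simp: shift_bounded_below_def eig bloch_norm_zero)
  then show False
    using c f bloch_norm_nonneg[OF f(1)] bloch_norm_eq_zero_iff[OF f(1)]
    by (simp add: mult_le_0_iff)
qed


section \<open>Spectra of linear isometries\<close>

context
  fixes T :: "(complex \<Rightarrow> complex) \<Rightarrow> complex \<Rightarrow> complex"
  assumes T: "bloch_bounded_operator T" and iso: "bloch_isometry T"
begin

lemma isometry_norm: "f \<in> bloch_space \<Longrightarrow> bloch_norm (T f) = bloch_norm f"
  using iso by (simp add: bloch_isometry_def)

lemma isometry_shift_bounded_below: "shift_bounded_below T \<mu> \<bar>1 - cmod \<mu>\<bar>"
  unfolding shift_bounded_below_def
proof
  fix f assume f: "f \<in> bloch_space"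
  note Tf = bloch_op_closed[OF T f] and mf = bloch_space_cmult[OF f, of \<mu>]
  show "\<bar>1 - cmod \<mu>\<bar> * bloch_norm f \<le> bloch_norm (\<lambda>z. T f z - \<mu> * f z)"
    using bloch_norm_diff_ge[OF Tf mf] bloch_norm_diff_ge[OF mf Tf] bloch_norm_minus_commute[OF Tf mf]
    by (simp add: isometry_norm f bloch_norm_cmult abs_if left_diff_distrib)
qed

lemma isometry_not_in_bloch_spectrum_iff:
  "cmod \<mu> \<noteq> 1 \<Longrightarrow> \<mu> \<notin> bloch_spectrum T \<longleftrightarrow> shift_onto T \<mu>"
  unfolding not_in_bloch_spectrum_iff[OF T]
  using isometry_shift_bounded_below[of \<mu>] by (auto intro!: exI[of _ "\<bar>1 - cmod \<mu>\<bar>"])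

text \<open>
  For $|\<mu>| > 1$ the equation $(T - \<mu>) f = g$ says that $f$ is fixed by the contraction
  $f \<mapsto> (T f - g) / \<mu>$.
\<close>

lemma isometry_shift_onto_outside:
  assumes \<mu>: "cmod \<mu> > 1"
  shows "shift_onto T \<mu>"
  unfolding shift_onto_def
proof
  fix g assume g: "g \<in> bloch_space"
  interpret Metric_space bloch_space bloch_dist by (rule Metric_space_bloch)
  define \<Phi> where "\<Phi> f = (\<lambda>z. inverse \<mu> * (T f z - g z))" for f
  have \<Phi>: "\<Phi> f \<in> bloch_space" if "f \<in> bloch_space" for f
    unfolding \<Phi>_def using that g by (intro bloch_space_cmult bloch_space_diff bloch_op_closed[OF T])
  have "bloch_dist (\<Phi> f) (\<Phi> h) \<le> inverse (cmod \<mu>) * bloch_dist f h"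
    if f: "f \<in> bloch_space" and h: "h \<in> bloch_space" for f h
  proof -
    note fh = bloch_space_diff[OF f h]
    have "(\<lambda>z. \<Phi> f z - \<Phi> h z) = (\<lambda>z. inverse \<mu> * T (\<lambda>z. f z - h z) z)"
      by (simp add: \<Phi>_def bloch_op_diff[OF T f h] algebra_simps)
    then have "bloch_norm (\<lambda>z. \<Phi> f z - \<Phi> h z) = inverse (cmod \<mu>) * bloch_norm (\<lambda>z. f z - h z)"
      by (simp add: bloch_norm_cmult bloch_op_closed[OF T] fh isometry_norm norm_inverse)
    then show ?thesis using f h \<Phi> by (simp add: bloch_dist_def)
  qed
  moreover have "inverse (cmod \<mu>) < 1" using \<mu> by (simp add: inverse_less_1_iff)
  ultimately obtain f where f: "f \<in> bloch_space" "\<Phi> f = f"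
    using Banach_fixedpoint_thm[OF mcomplete_bloch, of \<Phi> "inverse (cmod \<mu>)"] \<Phi> bloch_space_zero
    by (metis Pi_I emptyE)
  have "\<mu> \<noteq> 0" using \<mu> by auto
  then have "(\<lambda>z. T f z - \<mu> * f z) = g"
    using fun_cong[OF f(2)] by (simp add: \<Phi>_def fun_eq_iff field_simps)
  with f(1) show "\<exists>f\<in>bloch_space. (\<lambda>z. T f z - \<mu> * f z) = g" by blast
qed

lemma isometry_spectrum_subset: "bloch_spectrum T \<subseteq> cball 0 1"
proof
  fix \<mu> assume "\<mu> \<in> bloch_spectrum T"
  then show "\<mu> \<in> cball 0 1"
    using isometry_not_in_bloch_spectrum_iff[of \<mu>] isometry_shift_onto_outside[of \<mu>]
    by (auto simp: not_less[symmetric])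
qed

text \<open>
  Inside the disk $T - \<mu>$ is bounded below by $1 - |\<mu>| > 0$, which depends continuously on
  $\<mu>$. So surjectivity passes from any $\<mu>$ to a neighbourhood and also from a neighbourhood
  back to $\<mu>$, and the disk is connected.
\<close>

lemma isometry_shift_onto_ball_iff:
  assumes "\<mu> \<in> ball 0 1" "\<nu> \<in> ball 0 1"
  shows "shift_onto T \<mu> \<longleftrightarrow> shift_onto T \<nu>"
proof (rule connected_equivalence_relation[where S = "ball 0 1" and R = "\<lambda>\<mu> \<nu>. shift_onto T \<mu> \<longleftrightarrow> shift_onto T \<nu>"])
  fix a :: complex assume a: "a \<in> ball 0 1"
  have onto: "shift_onto T \<nu>"
    if "shift_onto T \<mu>" "cmod (\<nu> - \<mu>) < 1 - cmod \<mu>" for \<mu> \<nu>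
    using shift_onto_perturb[OF T isometry_shift_bounded_below that(1), of \<nu>] that(2) by linarith
  \<comment> \<open>Half the distance to the circle, so that each of the two points lies within the reach of the other.\<close>
  let ?U = "ball 0 1 \<inter> ball a ((1 - cmod a) / 2)"
  have "shift_onto T a \<longleftrightarrow> shift_onto T x" if "x \<in> ?U" for x
  proof -
    have d: "cmod (x - a) < (1 - cmod a) / 2"
      using that by (simp add: dist_norm norm_minus_commute)
    moreover have "cmod (a - x) < 1 - cmod x"
      using d norm_triangle_sub[of x a] by (simp add: norm_minus_commute)
    ultimately show ?thesis
      using onto[of a x] onto[of x a] norm_ge_zero[of "x - a"] by argo
  qed
  then show "\<exists>U. openin (top_of_set (ball 0 1)) U \<and> a \<in> U \<and> (\<forall>x\<in>U. shift_onto T a \<longleftrightarrow> shift_onto T x)"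
    using a by (intro exI[of _ ?U]) auto
qed (use assms in auto)

text \<open>
  By the previous lemma the spectrum contains all of the open disk or none of it, and the origin
  decides.
\<close>

lemma isometry_spectrum_onto:
  assumes "shift_onto T 0"
  shows "bloch_spectrum T \<subseteq> sphere 0 1"
proof
  fix \<mu> assume \<mu>: "\<mu> \<in> bloch_spectrum T"
  have "cmod \<mu> \<le> 1"
    using isometry_spectrum_subset \<mu> by auto
  moreover have "\<mu> \<notin> ball 0 1"
    using isometry_shift_onto_ball_iff[of 0 \<mu>] isometry_not_in_bloch_spectrum_iff[of \<mu>] \<mu> assms by auto
  ultimately show "\<mu> \<in> sphere 0 1" by simp
qed

lemma isometry_spectrum_not_onto:
  assumes "\<not> shift_onto T 0"
  shows "bloch_spectrum T = cball 0 1"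
proof
  have "ball 0 1 \<subseteq> bloch_spectrum T"
  proof
    fix \<mu> :: complex assume "\<mu> \<in> ball 0 1"
    then show "\<mu> \<in> bloch_spectrum T"
      using isometry_shift_onto_ball_iff[of 0 \<mu>] isometry_not_in_bloch_spectrum_iff[of \<mu>] assms
      by auto
  qed
  then have "closure (ball 0 1) \<subseteq> bloch_spectrum T"
    by (rule closure_minimal[OF _ closed_bloch_spectrum[OF T]])
  then show "cball 0 1 \<subseteq> bloch_spectrum T" by simp
qed (rule isometry_spectrum_subset)

end


section \<open>Isometric composition operators\<close>

text \<open>
  Three roles: the exponent 0 gives the constants, the exponent 1 gives the identity map, on which an
  isometric operator reveals its symbol, and all exponents give eigenvectors of rotations.
\<close>

definition disk_power :: "nat \<Rightarrow> complex \<Rightarrow> complex" where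
  "disk_power n = (\<lambda>z. if z \<in> ball 0 1 then z ^ n else 0)"

lemma deriv_disk_power:
  assumes "z \<in> ball 0 1"
  shows "deriv (disk_power n) z = of_nat n * z ^ (n - 1)"
proof (rule DERIV_imp_deriv)
  have "((\<lambda>z. z ^ n) has_field_derivative of_nat n * z ^ (n - 1)) (at z)"
    by (auto intro!: derivative_eq_intros)
  then show "(disk_power n has_field_derivative of_nat n * z ^ (n - 1)) (at z)"
    by (rule has_field_derivative_transform_within_open[OF _ open_ball assms])
      (simp add: disk_power_def)
qed

lemma disk_power_in_bloch_space: "disk_power n \<in> bloch_space"
proof (rule bloch_spaceI[where C = "real n"])
  have "(\<lambda>z. z ^ n) holomorphic_on ball 0 1"
    by (intro holomorphic_intros)
  then show "disk_power n holomorphic_on ball 0 1"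
    by (rule holomorphic_transform) (simp add: disk_power_def)
  fix z :: complex assume z: "z \<in> ball 0 1"
  then have "cmod z ^ (n - 1) \<le> 1" by (intro power_le_one) auto
  then have "cmod (deriv (disk_power n) z) \<le> real n"
    unfolding deriv_disk_power[OF z] norm_mult norm_power by (simp add: mult_left_le)
  moreover have "1 - (cmod z)\<^sup>2 \<le> 1" by simp
  ultimately show "(1 - (cmod z)\<^sup>2) * cmod (deriv (disk_power n) z) \<le> real n"
    using mult_mono[of "1 - (cmod z)\<^sup>2" 1 "cmod (deriv (disk_power n) z)" "real n"] by simp
qed (simp add: disk_power_def)

lemma bloch_seminorm_disk_power_1: "bloch_seminorm (disk_power 1) = 1"
proof (rule antisym)
  show "bloch_seminorm (disk_power 1) \<le> 1"
    by (rule bloch_seminorm_le) (simp add: deriv_disk_power[of _ 1, simplified])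
  show "1 \<le> bloch_seminorm (disk_power 1)"
    using deriv_le_bloch_seminorm[OF disk_power_in_bloch_space, of 0 1]
    by (simp add: deriv_disk_power[of 0 1, simplified])
qed

lemma bloch_norm_add_const:
  fixes c :: complex and f
  defines "g \<equiv> (\<lambda>z. c * disk_power 0 z + f z)"
  assumes f: "f \<in> bloch_space"
  shows "g \<in> bloch_space" "bloch_norm g = cmod (c + f 0) + bloch_seminorm f"
proof -
  show "g \<in> bloch_space"
    unfolding g_def by (intro bloch_space_add bloch_space_cmult disk_power_in_bloch_space f)
  have "deriv g z = deriv f z" if z: "z \<in> ball 0 1" for z
  proof (rule DERIV_imp_deriv)
    have "((\<lambda>z. c + f z) has_field_derivative deriv f z) (at z)"
      using holomorphic_derivI[OF bloch_space_holomorphic[OF f] open_ball z]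
      by (auto intro!: derivative_eq_intros)
    then show "(g has_field_derivative deriv f z) (at z)"
      by (rule has_field_derivative_transform_within_open[OF _ open_ball z])
        (simp add: g_def disk_power_def)
  qed
  then have "bloch_seminorm g = bloch_seminorm f"
    by (simp add: bloch_seminorm_def)
  then show "bloch_norm g = cmod (c + f 0) + bloch_seminorm f"
    by (simp add: bloch_norm_def g_def disk_power_def)
qed

context
  fixes \<phi> :: "complex \<Rightarrow> complex"
  assumes hol: "\<phi> holomorphic_on ball 0 1" and im: "\<phi> ` ball 0 1 \<subseteq> ball 0 1"
    and iso: "bloch_isometry (composition_operator \<phi>)"
begin

text \<open>
  With $w = \<phi>(0)$, the norms of $z + c$ and of $\<phi> + c$ agree for every constant $c$:
  $|w + c| + \<beta>_\<phi> = |c| + 1$. Compare $c = w$ with $c = -w$.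
\<close>

lemma isometric_symbol_fixes_0: "\<phi> 0 = 0"
proof -
  let ?C = "composition_operator \<phi>"
  define w where "w = \<phi> 0"
  have C: "?C (disk_power 1) \<in> bloch_space"
    by (rule composition_operator_in_bloch_space[OF hol im disk_power_in_bloch_space])
  have in_ball: "\<phi> z \<in> ball 0 1" if "z \<in> ball 0 1" for z
    using im that by blast
  have "cmod (c + w) + bloch_seminorm (?C (disk_power 1)) = cmod c + 1" for c
  proof -
    let ?g = "\<lambda>z. c * disk_power 0 z + disk_power 1 z"
    have "?C ?g = (\<lambda>z. c * disk_power 0 z + ?C (disk_power 1) z)"
      using in_ball by (auto simp: composition_operator_def disk_power_def)
    moreover have "bloch_norm (?C ?g) = bloch_norm ?g"
      using iso bloch_norm_add_const(1)[OF disk_power_in_bloch_space, of c 1]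
      by (simp add: bloch_isometry_def)
    moreover have "bloch_norm ?g = cmod c + 1"
      using bloch_norm_add_const(2)[OF disk_power_in_bloch_space, of c 1]
      unfolding bloch_seminorm_disk_power_1 by (simp add: disk_power_def)
    moreover have "?C (disk_power 1) 0 = w"
      using in_ball[of 0] by (simp add: composition_operator_def disk_power_def w_def)
    ultimately show ?thesis
      using bloch_norm_add_const(2)[OF C, of c] by metis
  qed
  from this[of w] this[of "- w"] have "cmod (w + w) = 0" by simp
  then show ?thesis by (simp add: w_def)
qed

lemma isometric_composition_seminorm:
  assumes f: "f \<in> bloch_space"
  shows "bloch_seminorm (composition_operator \<phi> f) = bloch_seminorm f"
  using iso f by (simp add: bloch_isometry_def bloch_norm_def composition_operator_def isometric_symbol_fixes_0)

text \<open>
  If the identity is $g \<circ> \<phi>$ with $g$ in the Bloch space, then $|g'(0)| \<le> \<beta>_g = 1$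
  and $g'(0) \<phi>'(0) = 1$, so $|\<phi>'(0)| \<ge> 1$ and the Schwarz lemma applies.
\<close>

lemma isometric_onto_imp_rotation:
  assumes onto: "shift_onto (composition_operator \<phi>) 0"
  shows "disk_rotation \<phi>"
proof -
  obtain g where g: "g \<in> bloch_space" and Cg: "composition_operator \<phi> g = disk_power 1"
    using onto disk_power_in_bloch_space[of 1] unfolding shift_onto_def by force
  have "bloch_seminorm g = 1"
    using isometric_composition_seminorm[OF g] by (simp add: Cg bloch_seminorm_disk_power_1[simplified])
  then have g0: "cmod (deriv g 0) \<le> 1"
    using deriv_le_bloch_seminorm[OF g, of 0] by simp
  have "(g has_field_derivative deriv g 0) (at (\<phi> 0))"
    using holomorphic_derivI[OF bloch_space_holomorphic[OF g] open_ball, of 0]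
    by (simp add: isometric_symbol_fixes_0)
  moreover have "(\<phi> has_field_derivative deriv \<phi> 0) (at 0)"
    using holomorphic_derivI[OF hol open_ball, of 0] by simp
  ultimately have "((\<lambda>z. g (\<phi> z)) has_field_derivative deriv g 0 * deriv \<phi> 0) (at 0)"
    by (rule DERIV_chain2)
  then have "((\<lambda>z. z) has_field_derivative deriv g 0 * deriv \<phi> 0) (at 0)"
  proof (rule has_field_derivative_transform_within_open[OF _ open_ball])
    show "g (\<phi> z) = z" if "z \<in> ball 0 1" for z
      using fun_cong[OF Cg, of z] that by (simp add: composition_operator_def disk_power_def)
  qed simp
  then have "deriv g 0 * deriv \<phi> 0 = 1"
    using DERIV_ident DERIV_unique by blast
  then have "1 = cmod (deriv g 0) * cmod (deriv \<phi> 0)"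
    by (metis norm_mult norm_one)
  also have "\<dots> \<le> cmod (deriv \<phi> 0)"
    using g0 by (simp add: mult_left_le_one_le)
  finally have ge: "1 \<le> cmod (deriv \<phi> 0)" .
  have lt: "cmod (\<phi> z) < 1" if "cmod z < 1" for z
    using im that by (auto simp: image_subset_iff)
  note Schwarz = Schwarz_Lemma[OF hol isometric_symbol_fixes_0 lt, of 0]
  have "cmod (deriv \<phi> 0) = 1"
    using ge Schwarz(2) by simp
  then obtain l where "\<forall>z. cmod z < 1 \<longrightarrow> \<phi> z = l * z" "cmod l = 1"
    using Schwarz(3) by auto
  then show ?thesis
    by (auto simp: disk_rotation_def)
qed

end


section \<open>Rotations\<close>

text \<open>
  Kronecker's theorem for the angle: $\<lambda> = e^{2 \<pi> i \<theta>}$ has finite order if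
  $\<theta>$ is rational, and otherwise the fractional parts of $n \<theta>$ with $n \<ge> 0$ are
  dense in $[0, 1]$. Nonnegative exponents matter: negative powers of $z$ are no eigenvectors.
\<close>

lemma sphere_subset_closure_powers:
  assumes l: "cmod l = 1" and ord: "mult_order l = \<infinity>"
  shows "sphere 0 1 \<subseteq> closure (range (\<lambda>n::nat. l ^ n))"
proof -
  define e where "e = (\<lambda>t::real. cis (2 * pi * t))"
  have e_surj: "\<exists>t. u = e t \<and> 0 \<le> t \<and> t \<le> 1" if u: "cmod u = 1" for u
  proof -
    obtain s where s: "0 \<le> s" "s < 2 * pi" "u = cis s"
      using u complex_unimodular_polar by (metis cis.ctr)
    then show ?thesis
      by (intro exI[of _ "s / (2 * pi)"]) (auto simp: e_def field_simps)
  qed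
  obtain \<theta> where \<theta>: "l = e \<theta>" using e_surj[OF l] by blast
  have e_int: "e (real_of_int k) = 1" for k
    using cis_multiple_2pi[of "real_of_int k"] by (simp add: e_def)
  have e_frac: "e (frac t) = e t" for t
    using e_int[of "\<lfloor>t\<rfloor>"] by (simp add: e_def frac_def algebra_simps flip: cis_divide)
  have pow: "l ^ n = e (real n * \<theta>)" for n
    using Complex.DeMoivre[of "2 * pi * \<theta>" n] by (simp add: \<theta> e_def mult_ac)
  have irr: "\<theta> \<notin> \<rat>"
  proof
    assume "\<theta> \<in> \<rat>"
    then obtain a b where ab: "b > 0" "\<theta> = real_of_int a / real_of_int b"
      by (meson Rats_cases')
    then have "l ^ nat b = 1"
      unfolding pow using e_int[of a] by simp
    then have "mult_order l \<noteq> \<infinity>"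
      using ab(1) by (auto simp: mult_order_def intro!: exI[of _ "nat b"])
    with ord show False by simp
  qed
  have cont: "continuous_on UNIV e"
    unfolding e_def by (intro continuous_intros)
  have "e ` {0..1} = e ` closure (range (\<lambda>n. frac (real n * \<theta>)))"
    by (simp only: Kronecker_approx_1[OF irr])
  also have "\<dots> \<subseteq> closure (e ` range (\<lambda>n. frac (real n * \<theta>)))"
    by (rule image_closure_subset[OF continuous_on_subset[OF cont] closed_closure closure_subset]) auto
  also have "e ` range (\<lambda>n. frac (real n * \<theta>)) = range (\<lambda>n. l ^ n)"
    by (simp add: image_image e_frac pow)
  finally show ?thesis
    using e_surj by (fastforce simp: image_subset_iff)
qed

text \<open>
  The first $k$ powers of $\<lambda>$ are distinct by minimality of $k$, and there are only $k$ roots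
  of unity to accommodate them.
\<close>

lemma roots_of_unity_eq_cyclic_group:
  assumes k: "k > 0" "l ^ k = 1" and min: "\<And>j. 0 < j \<Longrightarrow> j < k \<Longrightarrow> l ^ j \<noteq> (1::complex)"
  shows "{u. u ^ k = 1} = (\<lambda>n. l ^ n) ` {..<k}" and "cyclic_group_of l = {u. u ^ k = 1}"
proof -
  have l0: "l \<noteq> 0" using k by (auto simp: power_0_left)
  have inj: "inj_on (\<lambda>n. l ^ n) {..<k}"
  proof (rule linorder_inj_onI')
    fix i j assume "i \<in> {..<k}" "j \<in> {..<k}" "i < j"
    then have "l ^ j = l ^ i * l ^ (j - i)" "l ^ (j - i) \<noteq> 1"
      by (auto simp: min simp flip: power_add)
    then show "l ^ i \<noteq> l ^ j" using l0 by simp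
  qed
  have pow: "(\<lambda>n. l ^ n) ` {..<k} \<subseteq> {u. u ^ k = 1}"
    using k(2) by (auto simp flip: power_mult) (metis power_mult mult.commute power_one)
  show eq: "{u. u ^ k = 1} = (\<lambda>n. l ^ n) ` {..<k}"
    by (rule card_seteq[symmetric, OF _ pow])
      (use k(1) in \<open>auto simp: card_image[OF inj] finite_roots_unity card_complex_roots_unity\<close>)
  show "cyclic_group_of l = {u. u ^ k = 1}"
  proof
    have "(l powi n) ^ k = 1" for n
    proof -
      have "(l powi n) ^ k = (l ^ k) powi n"
        by (metis power_int_mult power_int_of_nat mult.commute)
      then show ?thesis by (simp add: k(2))
    qed
    then show "cyclic_group_of l \<subseteq> {u. u ^ k = 1}"
      by (auto simp: cyclic_group_of_def)
    show "{u. u ^ k = 1} \<subseteq> cyclic_group_of l"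
      unfolding eq cyclic_group_of_def by (auto intro!: image_eqI[of _ _ "int _"])
  qed
qed

context
  fixes \<phi> :: "complex \<Rightarrow> complex" and l :: complex
  assumes hol: "\<phi> holomorphic_on ball 0 1" and im: "\<phi> ` ball 0 1 \<subseteq> ball 0 1"
    and iso: "bloch_isometry (composition_operator \<phi>)"
    and l: "cmod l = 1" and rot: "\<And>z. z \<in> ball 0 1 \<Longrightarrow> \<phi> z = l * z"
begin

lemma rotation_operator: "bloch_bounded_operator (composition_operator \<phi>)"
  by (rule bloch_bounded_operator_composition[OF hol im iso])

lemma rotation_composition_eq:
  assumes "f \<in> bloch_space"
  shows "composition_operator \<phi> f = (\<lambda>z. f (l * z))"
  using bloch_space_outside[OF assms] by (auto simp: composition_operator_def rot norm_mult l)

lemma rotation_power_in_spectrum: "l ^ n \<in> bloch_spectrum (composition_operator \<phi>)"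
proof (rule eigenvalue_in_bloch_spectrum[OF rotation_operator disk_power_in_bloch_space])
  have "disk_power n (1 / 2) \<noteq> 0" by (simp add: disk_power_def)
  then show "disk_power n \<noteq> (\<lambda>z. 0)" by metis
  show "composition_operator \<phi> (disk_power n) = (\<lambda>z. l ^ n * disk_power n z)"
    unfolding rotation_composition_eq[OF disk_power_in_bloch_space]
    by (auto simp: disk_power_def norm_mult l power_mult_distrib)
qed

lemma rotation_onto: "shift_onto (composition_operator \<phi>) 0"
  unfolding shift_onto_def
proof
  fix g assume g: "g \<in> bloch_space"
  let ?f = "composition_operator (\<lambda>z. inverse l * z) g"
  have f: "?f \<in> bloch_space"
    by (rule composition_operator_in_bloch_space[OF _ _ g])
      (auto intro!: holomorphic_intros simp: norm_mult norm_inverse l)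
  have "l \<noteq> 0" using l by auto
  then have "g (inverse l * (l * z)) = g z" for z by (simp add: mult.assoc[symmetric])
  then have "composition_operator \<phi> ?f z = g z" for z
    unfolding rotation_composition_eq[OF f] using bloch_space_outside[OF g, of z]
    by (auto simp: composition_operator_def norm_mult l)
  with f show "\<exists>f\<in>bloch_space. (\<lambda>z. composition_operator \<phi> f z - 0 * f z) = g"
    by (intro bexI[of _ ?f]) auto
qed

lemma rotation_iterate:
  assumes f: "f \<in> bloch_space"
  shows "(\<lambda>z. f (l ^ j * z)) \<in> bloch_space \<and> bloch_norm (\<lambda>z. f (l ^ j * z)) = bloch_norm f"
proof (induction j)
  case (Suc j)
  let ?h = "\<lambda>z. f (l ^ j * z)"
  have "(\<lambda>z. f (l ^ Suc j * z)) = composition_operator \<phi> ?h"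
    using rotation_composition_eq[of ?h] Suc by (simp add: mult.assoc mult.left_commute)
  with Suc show ?case
    using bloch_op_closed[OF rotation_operator, of ?h] isometry_norm[OF rotation_operator iso, of ?h]
    by simp
qed (simp add: f)

text \<open>
  If $\<lambda>^k = 1$, then $C_\<phi>^k$ is the identity and
  $(C_\<phi> - \<mu>) \<Sum>_{j<k} \<mu>^{k-1-j} C_\<phi>^j = C_\<phi>^k - \<mu>^k = 1 - \<mu>^k$.
\<close>

lemma rotation_finite_order_not_in_spectrum:
  assumes k: "l ^ k = 1" and \<mu>: "\<mu> ^ k \<noteq> 1"
  shows "\<mu> \<notin> bloch_spectrum (composition_operator \<phi>)"
proof -
  let ?C = "composition_operator \<phi>"
  define c where "c j = \<mu> ^ (k - 1 - j) / (1 - \<mu> ^ k)" for j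
  define S where "S f = (\<lambda>z. \<Sum>j<k. c j * f (l ^ j * z))" for f
  have term_mem: "(\<lambda>z. c j * f (l ^ j * z)) \<in> bloch_space" if "f \<in> bloch_space" for f j
    using rotation_iterate[OF that] by (intro bloch_space_cmult) blast
  have S_mem: "S f \<in> bloch_space" if "f \<in> bloch_space" for f
    unfolding S_def by (intro bloch_space_sum term_mem that)
  have "bloch_norm (S f) \<le> (\<Sum>j<k. cmod (c j)) * bloch_norm f" if f: "f \<in> bloch_space" for f
  proof -
    have "bloch_norm (S f) \<le> (\<Sum>j<k. bloch_norm (\<lambda>z. c j * f (l ^ j * z)))"
      unfolding S_def by (intro bloch_norm_sum_le term_mem f)
    also have "\<dots> = (\<Sum>j<k. cmod (c j) * bloch_norm f)"
      using rotation_iterate[OF f] by (intro sum.cong refl) (simp add: bloch_norm_cmult)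
    finally show ?thesis by (simp add: sum_distrib_right)
  qed
  moreover have "S (\<lambda>z. f z + g z) = (\<lambda>z. S f z + S g z)" for f g
    by (simp add: S_def fun_eq_iff sum.distrib algebra_simps)
  moreover have "S (\<lambda>z. a * f z) = (\<lambda>z. a * S f z)" for a f
    by (simp add: S_def fun_eq_iff sum_distrib_left algebra_simps)
  ultimately have "bloch_bounded_operator S"
    unfolding bloch_bounded_operator_def using S_mem by blast
  have telescope: "(\<Sum>j<k. c j * (a (Suc j) - \<mu> * a j)) = a 0" if "a k = a 0" for a :: "nat \<Rightarrow> complex"
  proof -
    have "c j * (a (Suc j) - \<mu> * a j)
        = (\<mu> ^ (k - Suc j) * a (Suc j) - \<mu> ^ (k - j) * a j) / (1 - \<mu> ^ k)" if "j < k" for j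
    proof -
      have "\<mu> ^ (k - j) = \<mu> ^ (k - Suc j) * \<mu>"
        using that by (metis Suc_diff_Suc power_Suc2)
      then show ?thesis by (simp add: c_def algebra_simps)
    qed
    then have "(\<Sum>j<k. c j * (a (Suc j) - \<mu> * a j))
        = (\<Sum>j<k. \<mu> ^ (k - Suc j) * a (Suc j) - \<mu> ^ (k - j) * a j) / (1 - \<mu> ^ k)"
      by (simp add: sum_divide_distrib)
    also have "\<dots> = (a k - \<mu> ^ k * a 0) / (1 - \<mu> ^ k)"
      using sum_lessThan_telescope[of "\<lambda>j. \<mu> ^ (k - j) * a j" k] by simp
    also have "\<dots> = (1 - \<mu> ^ k) * a 0 / (1 - \<mu> ^ k)"
      unfolding that by (simp add: algebra_simps)
    also have "\<dots> = a 0" using \<mu> by simp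
    finally show ?thesis .
  qed
  have inv: "(\<Sum>j<k. c j * (f (l ^ Suc j * z) - \<mu> * f (l ^ j * z))) = f z" for f z
    using telescope[of "\<lambda>j. f (l ^ j * z)"] by (simp add: k)
  have "S (\<lambda>z. ?C f z - \<mu> * f z) = f" and "(\<lambda>z. ?C (S f) z - \<mu> * S f z) = f"
    if f: "f \<in> bloch_space" for f
  proof -
    show "S (\<lambda>z. ?C f z - \<mu> * f z) = f"
      using inv[of f] by (simp add: S_def rotation_composition_eq[OF f] fun_eq_iff mult.assoc)
    have "?C (S f) z - \<mu> * S f z = (\<Sum>j<k. c j * (f (l ^ Suc j * z) - \<mu> * f (l ^ j * z)))" for z
      unfolding rotation_composition_eq[OF S_mem[OF f]] unfolding S_def
      by (simp add: sum_distrib_left sum_subtractf[symmetric] algebra_simps)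
    then show "(\<lambda>z. ?C (S f) z - \<mu> * S f z) = f"
      unfolding inv by (rule ext)
  qed
  with \<open>bloch_bounded_operator S\<close> show ?thesis
    unfolding bloch_spectrum_def by blast
qed

lemma rotation_spectrum:
  "bloch_spectrum (composition_operator \<phi>)
     = (if mult_order l = \<infinity> then sphere 0 1 else cyclic_group_of l)"
proof (cases "mult_order l = \<infinity>")
  case True
  have "closure (range (\<lambda>n::nat. l ^ n)) \<subseteq> bloch_spectrum (composition_operator \<phi>)"
    using rotation_power_in_spectrum
    by (intro closure_minimal closed_bloch_spectrum rotation_operator) auto
  with sphere_subset_closure_powers[OF l True] isometry_spectrum_onto[OF rotation_operator iso rotation_onto]
  show ?thesis using True by auto
next
  case False
  then have "\<exists>k::nat. k > 0 \<and> l ^ k = 1"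
    by (auto simp: mult_order_def split: if_splits)
  then obtain k :: nat where k: "k > 0" "l ^ k = 1" and min: "\<And>j. 0 < j \<Longrightarrow> j < k \<Longrightarrow> l ^ j \<noteq> 1"
    using exists_least_iff[of "\<lambda>k. k > 0 \<and> l ^ k = 1"] by blast
  note G = roots_of_unity_eq_cyclic_group[OF k min]
  have "bloch_spectrum (composition_operator \<phi>) = {u. u ^ k = 1}"
  proof
    show "bloch_spectrum (composition_operator \<phi>) \<subseteq> {u. u ^ k = 1}"
      using rotation_finite_order_not_in_spectrum[OF k(2)] by blast
    show "{u. u ^ k = 1} \<subseteq> bloch_spectrum (composition_operator \<phi>)"
      using rotation_power_in_spectrum by (subst G(1)) auto
  qed
  then show ?thesis by (simp only: False if_False G(2))
qed

end

theorem theorem7p7: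
  fixes \<phi> :: "complex \<Rightarrow> complex"
  assumes "\<phi> holomorphic_on ball 0 1"
    and "\<phi> ` ball 0 1 \<subseteq> ball 0 1"
    and "bloch_isometry (composition_operator \<phi>)"
  shows "(\<not> disk_rotation \<phi> \<longrightarrow> bloch_spectrum (composition_operator \<phi>) = cball 0 1) \<and>
    (\<forall>l::complex. cmod l = 1 \<and> (\<forall>z\<in>ball 0 1. \<phi> z = l * z) \<longrightarrow>
       bloch_spectrum (composition_operator \<phi>) =
         (if mult_order l = \<infinity> then sphere 0 1 else cyclic_group_of l))"
proof (intro conjI impI allI)
  assume "\<not> disk_rotation \<phi>"
  then have "\<not> shift_onto (composition_operator \<phi>) 0"
    using isometric_onto_imp_rotation[OF assms] by blast
  then show "bloch_spectrum (composition_operator \<phi>) = cball 0 1"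
    by (rule isometry_spectrum_not_onto[OF bloch_bounded_operator_composition[OF assms] assms(3)])
next
  fix l :: complex
  assume "cmod l = 1 \<and> (\<forall>z\<in>ball 0 1. \<phi> z = l * z)"
  then show "bloch_spectrum (composition_operator \<phi>)
      = (if mult_order l = \<infinity> then sphere 0 1 else cyclic_group_of l)"
    by (intro rotation_spectrum[OF assms]) auto
qed

end
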